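(* Let $G$ be a finite loopless graph with vertex set $\{1,\dots,n\}$ and non-empty edge set $E=\{e_1,\dots,e_{|E|}\}$, indexed increasingly with respect to the lexicographical order on edges, and let $A(H)$ be the adjacency matrix of its conflict graph $H$. For $1\le k\le |E|$ let $E^k=\{e_1,\dots,e_k\}$, let $L_k$ be the set of all maximal non-conflicted subsets of $E^k$, and for $k<|E|$ let $B^{k+1}$ be the set of edges in $E^k$ that are not in conflict with $e_{k+1}$. Then the following recursive procedure correctly computes all the $L_k$, and in particular the set $L_{|E|}$ of all maximal non-conflicted subsets of $E$: $L_1=\{\{e_1\}\}$, and for every $1\le k<|E|$, $L_{k+1}$ consists exactly of (a) the sets $F\in L_k$ with $F\not\subseteq B^{k+1}$, and (b) the sets $(F\cap B^{k+1})\cup\{e_{k+1}\}$, where $F\in L_k$ is such that for every $l$ with $e_l\in B^{k+1}\setminus F$, $$\sum_{e_j\in F\cap B^{k+1}} A(H)_{l,j}\ \ge\ 1 .$$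
   Context: Each edge of $G$ is identified with the pair $\{\underline{m},\overline{m}\}$, $\underline{m}<\overline{m}$, of its end vertices. Two edges $\{\underline{m},\overline{m}\}$ and $\{\underline{l},\overline{l}\}$ are in conflict if the open intervals $(\underline{m},\overline{m})$ and $(\underline{l},\overline{l})$ have a non-empty intersection different from both intervals; equivalently $\underline{m}<\underline{l}<\overline{m}<\overline{l}$ or $\underline{l}<\underline{m}<\overline{l}<\overline{m}$. The conflict graph $H$ has vertex set $E$, and its edges are exactly the pairs of conflicting edges of $G$; so $A(H)_{i,j}=1$ if $e_i$ and $e_j$ are in conflict and $A(H)_{i,j}=0$ otherwise. The lexicographical order on edges is: $\{\underline{m},\overline{m}\}>\{\underline{l},\overline{l}\}$ if either $\overline{l}<\overline{m}$, or $\overline{l}=\overline{m}$ and $\underline{l}<\underline{m}$. A maximal non-conflicted subset of a set $S\subseteq E$ is a subset of $S$ with no two edges in conflict that is maximal by inclusion among such subsets of $S$. *)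

theory Defs
  imports Complex_Main
begin

type_synonym 'a graph = "'a set \<times> 'a set set"

definition finite_loopless_graph :: "'a graph \<Rightarrow> bool" where
  "finite_loopless_graph G \<longleftrightarrow>
     finite (fst G) \<and> (\<forall>x \<in> snd G. x \<subseteq> fst G \<and> card x = 2)"

definition adjacency_matrix :: "'a graph \<Rightarrow> (nat \<Rightarrow> 'a) \<Rightarrow> nat \<Rightarrow> nat \<Rightarrow> real" where
  "adjacency_matrix G v i j = (if {v i, v j} \<in> snd G then 1 else 0)"

text \<open>The interval of an edge is an interval of real numbers: over the natural numbers the edges
  \<open>{1, 3}\<close> and \<open>{2, 4}\<close> would give the disjoint sets \<open>{2}\<close> and \<open>{3}\<close>.\<close>

definition edge_interval :: "nat set \<Rightarrow> real set" where
  "edge_interval x = {real (Min x) <..< real (Max x)}"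

definition conflict :: "nat set \<Rightarrow> nat set \<Rightarrow> bool" where
  "conflict x y \<longleftrightarrow>
     edge_interval x \<inter> edge_interval y \<noteq> {} \<and>
     edge_interval x \<inter> edge_interval y \<noteq> edge_interval x \<and>
     edge_interval x \<inter> edge_interval y \<noteq> edge_interval y"

lemma conflict_iff:
  assumes "Min x < Max x" and "Min y < Max y"
  shows "conflict x y \<longleftrightarrow>
    (Min x < Min y \<and> Min y < Max x \<and> Max x < Max y) \<or>
    (Min y < Min x \<and> Min x < Max y \<and> Max y < Max x)"
proof -
  have eq: "edge_interval x \<inter> edge_interval y =
      {max (real (Min x)) (real (Min y)) <..< min (real (Max x)) (real (Max y))}"
    by (auto simp: edge_interval_def)
  have ne: "{a <..< b} = {c <..< d} \<longleftrightarrow> a = c \<and> b = d" if "c < d" for a b c d :: real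
  proof
    assume *: "{a <..< b} = {c <..< d}"
    with that have "a < b" by (metis greaterThanLessThan_empty_iff not_le)
    with that * show "a = c \<and> b = d"
      by (metis cInf_greaterThanLessThan cSup_greaterThanLessThan)
  qed simp
  show ?thesis
    unfolding conflict_def eq unfolding edge_interval_def
    using assms by (auto simp: ne max_def min_def)
qed

definition conflict_graph :: "nat set set \<Rightarrow> nat set graph" where
  "conflict_graph E = (E, {{x, y} | x y. x \<in> E \<and> y \<in> E \<and> conflict x y})"

definition lex_less :: "nat set \<Rightarrow> nat set \<Rightarrow> bool" where
  "lex_less x y \<longleftrightarrow> Max x < Max y \<or> (Max x = Max y \<and> Min x < Min y)"

definition lex_indexing :: "nat set set \<Rightarrow> (nat \<Rightarrow> nat set) \<Rightarrow> bool" where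
  "lex_indexing E e \<longleftrightarrow>
     bij_betw e {1..card E} E \<and>
     (\<forall>i \<in> {1..card E}. \<forall>j \<in> {1..card E}. i < j \<longrightarrow> lex_less (e i) (e j))"

definition non_conflicted :: "nat set set \<Rightarrow> bool" where
  "non_conflicted F \<longleftrightarrow> (\<forall>x \<in> F. \<forall>y \<in> F. \<not> conflict x y)"

definition maximal_non_conflicted :: "nat set set \<Rightarrow> nat set set set" where
  "maximal_non_conflicted S =
     {F. F \<subseteq> S \<and> non_conflicted F \<and>
         (\<forall>F'. F' \<subseteq> S \<and> non_conflicted F' \<and> F \<subseteq> F' \<longrightarrow> F' = F)}"

definition first_edges :: "(nat \<Rightarrow> nat set) \<Rightarrow> nat \<Rightarrow> nat set set" where
  "first_edges e k = e ` {1..k}"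

text \<open>\<open>compatible_edges e k\<close> is the set $B^{k+1}$: the superscript is that of the edge
  \<open>e (k + 1)\<close>, while its members are taken from the first \<open>k\<close> edges.\<close>

definition compatible_edges :: "(nat \<Rightarrow> nat set) \<Rightarrow> nat \<Rightarrow> nat set set" where
  "compatible_edges e k = {x \<in> first_edges e k. \<not> conflict x (e (k + 1))}"

definition recursion_step ::
  "nat set set \<Rightarrow> (nat \<Rightarrow> nat set) \<Rightarrow> nat \<Rightarrow> nat set set set \<Rightarrow> nat set set set" where
  "recursion_step E e k L =
     (let A = adjacency_matrix (conflict_graph E) e; B = compatible_edges e k in
        {F \<in> L. \<not> F \<subseteq> B} \<union>
        {(F \<inter> B) \<union> {e (k + 1)} | F. F \<in> L \<and>
           (\<forall>l \<in> {1..card E}. e l \<in> B - F \<longrightarrow>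
              (\<Sum>j \<in> {j \<in> {1..card E}. e j \<in> F \<inter> B}. A l j) \<ge> 1)})"

text \<open>The procedure starts at index 1; its value at 0 is a dummy.\<close>

fun computed_sets ::
  "nat set set \<Rightarrow> (nat \<Rightarrow> nat set) \<Rightarrow> nat \<Rightarrow> nat set set set" where
  "computed_sets E e 0 = {}"
| "computed_sets E e (Suc 0) = {{e 1}}"
| "computed_sets E e (Suc (Suc k)) = recursion_step E e (Suc k) (computed_sets E e (Suc k))"

end

theory Submission
  imports Defs
begin

text \<open>The maximal non-conflicted sets are the maximal independent sets of the conflict graph, and the
  recursion is their behaviour when a vertex \<open>v\<close> is added to a vertex set \<open>S\<close>. Let \<open>B\<close> be the set of
  non-neighbours of \<open>v\<close> in \<open>S\<close>. A maximal set of \<open>insert v S\<close> that misses \<open>v\<close> is a maximal set of \<open>S\<close>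
  meeting the neighbourhood of \<open>v\<close>. One that contains \<open>v\<close> is \<open>insert v D\<close> with \<open>D\<close> maximal in \<open>B\<close>;
  extending \<open>D\<close> to a maximal set \<open>F\<close> of \<open>S\<close> gives \<open>D = F \<inter> B\<close>, and the condition on the row sums of
  the adjacency matrix says that \<open>F \<inter> B\<close> is maximal in \<open>B\<close>.\<close>

lemma conflict_commute: "conflict x y \<longleftrightarrow> conflict y x"
  by (auto simp: conflict_def Int_commute)

lemma conflict_irrefl [simp]: "\<not> conflict x x"
  by (simp add: conflict_def)

lemma non_conflicted_insert:
  "non_conflicted (insert x F) \<longleftrightarrow> non_conflicted F \<and> (\<forall>y \<in> F. \<not> conflict x y)"
  unfolding non_conflicted_def by (auto simp: conflict_commute)

lemma non_conflicted_subset: "non_conflicted F \<Longrightarrow> D \<subseteq> F \<Longrightarrow> non_conflicted D"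
  unfolding non_conflicted_def by blast

text \<open>Maximality need only be tested on one-element extensions: a strictly larger
  non-conflicted set contains some \<open>x\<close> in \<open>S - F\<close>, and
  \<open>insert x F\<close> is then non-conflicted as well.\<close>

lemma mem_maximal_non_conflicted_iff:
  "F \<in> maximal_non_conflicted S \<longleftrightarrow>
     F \<subseteq> S \<and> non_conflicted F \<and> (\<forall>x \<in> S - F. \<exists>y \<in> F. conflict x y)"
proof (intro iffI)
  assume F: "F \<in> maximal_non_conflicted S"
  have "\<exists>y \<in> F. conflict x y" if "x \<in> S - F" for x
  proof (rule ccontr)
    assume "\<not> (\<exists>y \<in> F. conflict x y)"
    with F that have "insert x F \<subseteq> S" "non_conflicted (insert x F)"
      by (auto simp: maximal_non_conflicted_def non_conflicted_insert)
    with F have "insert x F = F"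
      unfolding maximal_non_conflicted_def by blast
    with that show False by blast
  qed
  with F show "F \<subseteq> S \<and> non_conflicted F \<and> (\<forall>x \<in> S - F. \<exists>y \<in> F. conflict x y)"
    by (simp add: maximal_non_conflicted_def)
next
  assume "F \<subseteq> S \<and> non_conflicted F \<and> (\<forall>x \<in> S - F. \<exists>y \<in> F. conflict x y)"
  then show "F \<in> maximal_non_conflicted S"
    unfolding maximal_non_conflicted_def non_conflicted_def by blast
qed

lemma non_conflicted_extend:
  assumes "finite S" and "D \<subseteq> S" and "non_conflicted D"
  obtains F where "F \<in> maximal_non_conflicted S" and "D \<subseteq> F"
proof -
  let ?A = "{F. F \<subseteq> S \<and> non_conflicted F}"
  have "finite ?A" using assms(1) by simp
  moreover have "D \<in> ?A" using assms by simp
  ultimately obtain F where F: "F \<in> ?A" "D \<subseteq> F" "\<forall>F' \<in> ?A. F \<subseteq> F' \<longrightarrow> F = F'"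
    using finite_has_maximal2[of ?A D] by blast
  then have "F \<in> maximal_non_conflicted S"
    unfolding maximal_non_conflicted_def by blast
  with F(2) show ?thesis by (rule that[rotated])
qed

lemma maximal_non_conflicted_insert:
  assumes "finite S" and v: "v \<notin> S"
  defines "B \<equiv> {x \<in> S. \<not> conflict x v}"
  shows "maximal_non_conflicted (insert v S) =
    {F \<in> maximal_non_conflicted S. \<not> F \<subseteq> B} \<union>
    {(F \<inter> B) \<union> {v} | F. F \<in> maximal_non_conflicted S \<and>
       (\<forall>x \<in> B - F. \<exists>y \<in> F \<inter> B. conflict x y)}"
    (is "?M = ?P \<union> ?Q")
proof (intro equalityI subsetI)
  fix F' assume F': "F' \<in> ?M"
  show "F' \<in> ?P \<union> ?Q"
  proof (cases "v \<in> F'")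
    case False
    with F' obtain y where "y \<in> F'" "conflict v y"
      unfolding mem_maximal_non_conflicted_iff by blast
    then have "\<not> F' \<subseteq> B" by (auto simp: B_def conflict_commute)
    moreover have "F' \<in> maximal_non_conflicted S"
      using F' False by (auto simp: mem_maximal_non_conflicted_iff)
    ultimately show ?thesis by blast
  next
    case True
    define D where "D = F' - {v}"
    have F'_eq: "F' = D \<union> {v}" using True by (auto simp: D_def)
    have D: "D \<subseteq> B" "non_conflicted D" "D \<subseteq> S"
      using F' True unfolding mem_maximal_non_conflicted_iff non_conflicted_def D_def B_def
      by blast+
    \<comment> \<open>Maximality of \<open>F'\<close> gives an element of \<open>F'\<close> in
      conflict with \<open>x\<close>; it is not \<open>v\<close>, because \<open>x\<close> lies in
      \<open>B\<close>, so it lies in \<open>D\<close>.\<close>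
    have D_max: "\<exists>y \<in> D. conflict x y" if "x \<in> B - D" for x
      using F' that v unfolding mem_maximal_non_conflicted_iff D_def B_def by blast
    obtain F where F: "F \<in> maximal_non_conflicted S" "D \<subseteq> F"
      using non_conflicted_extend[OF assms(1) D(3) D(2)] .
    have "non_conflicted F" using F(1) by (simp add: mem_maximal_non_conflicted_iff)
    \<comment> \<open>An element of \<open>F \<inter> B\<close> outside \<open>D\<close> would
      conflict with some element of \<open>D\<close>, and both would lie in the non-conflicted set
      \<open>F\<close>.\<close>
    have FB: "F \<inter> B = D"
      using D(1) F(2) D_max \<open>non_conflicted F\<close> unfolding non_conflicted_def by blast
    have "\<forall>x \<in> B - F. \<exists>y \<in> F \<inter> B. conflict x y" using FB D_max by blast
    then have "F' \<in> ?Q" using F'_eq FB F(1) by blast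
    then show ?thesis ..
  qed
next
  fix F' assume "F' \<in> ?P \<union> ?Q"
  then show "F' \<in> ?M"
  proof
    assume "F' \<in> ?P"
    then have F': "F' \<subseteq> S" "non_conflicted F'" "\<forall>x \<in> S - F'. \<exists>y \<in> F'. conflict x y"
      and "\<not> F' \<subseteq> B"
      by (auto simp: mem_maximal_non_conflicted_iff)
    \<comment> \<open>An element of \<open>F'\<close> outside \<open>B\<close> conflicts with
      \<open>v\<close>, which blocks the only new candidate for extending \<open>F'\<close>.\<close>
    then have "\<exists>y \<in> F'. conflict v y" by (auto simp: B_def conflict_commute)
    with F' show ?thesis by (auto simp: mem_maximal_non_conflicted_iff)
  next
    assume "F' \<in> ?Q"
    then obtain F where F: "F \<in> maximal_non_conflicted S"
      "\<forall>x \<in> B - F. \<exists>y \<in> F \<inter> B. conflict x y" and F'_eq: "F' = insert v (F \<inter> B)"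
      by auto
    have "F' \<subseteq> insert v S" by (auto simp: F'_eq B_def)
    moreover have "non_conflicted F'"
      using F(1) unfolding F'_eq non_conflicted_insert mem_maximal_non_conflicted_iff
      by (auto simp: B_def conflict_commute intro: non_conflicted_subset)
    moreover have "\<exists>y \<in> F'. conflict x y" if "x \<in> insert v S - F'" for x
    proof (cases "x \<in> B")
      case True
      then show ?thesis using that F(2) unfolding F'_eq by blast
    next
      \<comment> \<open>Here \<open>x\<close> lies in \<open>S\<close> but not in \<open>B\<close>,
        so the required element of \<open>F'\<close> is \<open>v\<close> itself.\<close>
      case False
      then show ?thesis using that by (auto simp: F'_eq B_def)
    qed
    ultimately show ?thesis by (simp add: mem_maximal_non_conflicted_iff)
  qed
qed

lemma adjacency_matrix_conflict_graph:
  assumes "e i \<in> E" and "e j \<in> E"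
  shows "adjacency_matrix (conflict_graph E) e i j = (if conflict (e i) (e j) then 1 else 0)"
proof -
  have "{e i, e j} \<in> snd (conflict_graph E) \<longleftrightarrow> conflict (e i) (e j)"
    using assms by (auto simp: conflict_graph_def doubleton_eq_iff conflict_commute)
  then show ?thesis by (simp add: adjacency_matrix_def)
qed

lemma sum_indicator_ge_1_iff:
  assumes "finite J"
  shows "(\<Sum>j \<in> J. if P j then 1 else 0 :: real) \<ge> 1 \<longleftrightarrow> (\<exists>j \<in> J. P j)"
proof -
  have "(\<Sum>j \<in> J. if P j then 1 else 0 :: real) = real (card {j \<in> J. P j})"
    using assms by (simp add: sum.If_cases Int_def)
  moreover have "card {j \<in> J. P j} \<ge> 1 \<longleftrightarrow> (\<exists>j \<in> J. P j)"
    using assms by (auto simp: Suc_le_eq card_gt_0_iff)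
  ultimately show ?thesis by simp
qed

text \<open>Each row sum counts the members of \<open>F \<inter> B\<close> in conflict with
  \<open>e l\<close>, so it is at least 1 exactly when one exists. Since \<open>e\<close> maps onto
  \<open>E\<close>, quantifying over indices amounts to quantifying over edges.\<close>

lemma row_sums_ge_1_iff:
  assumes bij: "bij_betw e {1..card E} E" and "B \<subseteq> E"
  shows "(\<forall>l \<in> {1..card E}. e l \<in> B - F \<longrightarrow>
      (\<Sum>j \<in> {j \<in> {1..card E}. e j \<in> F \<inter> B}. adjacency_matrix (conflict_graph E) e l j) \<ge> 1)
    \<longleftrightarrow> (\<forall>x \<in> B - F. \<exists>y \<in> F \<inter> B. conflict x y)"
proof -
  have index: "\<exists>i \<in> {1..card E}. x = e i" if "x \<in> B" for x
    using bij_betw_imp_surj_on[OF bij] that \<open>B \<subseteq> E\<close> by blast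
  have e: "e i \<in> E" if "i \<in> {1..card E}" for i
    using bij that by (rule bij_betw_apply)
  have "(\<Sum>j \<in> {j \<in> {1..card E}. e j \<in> F \<inter> B}. adjacency_matrix (conflict_graph E) e l j) \<ge> 1
      \<longleftrightarrow> (\<exists>y \<in> F \<inter> B. conflict (e l) y)" if l: "l \<in> {1..card E}" for l
  proof -
    let ?J = "{j \<in> {1..card E}. e j \<in> F \<inter> B}"
    have "(\<Sum>j \<in> ?J. adjacency_matrix (conflict_graph E) e l j) =
        (\<Sum>j \<in> ?J. if conflict (e l) (e j) then 1 else 0)"
      using e l by (intro sum.cong refl adjacency_matrix_conflict_graph) auto
    then have "(\<Sum>j \<in> ?J. adjacency_matrix (conflict_graph E) e l j) \<ge> 1 \<longleftrightarrow>
        (\<exists>j \<in> ?J. conflict (e l) (e j))"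
      by (simp add: sum_indicator_ge_1_iff)
    also have "\<dots> \<longleftrightarrow> (\<exists>y \<in> F \<inter> B. conflict (e l) y)" using index by blast
    finally show ?thesis .
  qed
  then have "?thesis \<longleftrightarrow>
      ((\<forall>l \<in> {1..card E}. e l \<in> B - F \<longrightarrow> (\<exists>y \<in> F \<inter> B. conflict (e l) y))
       \<longleftrightarrow> (\<forall>x \<in> B - F. \<exists>y \<in> F \<inter> B. conflict x y))"
    by simp
  also have \<dots> using index by blast
  finally show ?thesis by blast
qed

lemma maximal_non_conflicted_first_edges_Suc:
  assumes bij: "bij_betw e {1..card E} E" and k: "k < card E"
  shows "maximal_non_conflicted (first_edges e (k + 1)) =
    recursion_step E e k (maximal_non_conflicted (first_edges e k))"
proof -
  have inj: "inj_on e {1..card E}" and E: "e ` {1..card E} = E"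
    using bij by (auto simp: bij_betw_def)
  \<comment> \<open>The insertion lemma is applied with \<open>v = e (k + 1)\<close>, which is a new
    element by injectivity of \<open>e\<close>; its set \<open>B\<close> is then
    \<open>compatible_edges e k\<close>.\<close>
  have "first_edges e (k + 1) = insert (e (k + 1)) (first_edges e k)"
    by (simp add: first_edges_def atLeastAtMostSuc_conv)
  moreover have "e (k + 1) \<notin> first_edges e k"
    using inj k unfolding first_edges_def by (auto dest: inj_onD)
  moreover have "finite (first_edges e k)" by (simp add: first_edges_def)
  moreover have "compatible_edges e k \<subseteq> E"
    using k E by (auto simp: compatible_edges_def first_edges_def)
  ultimately show ?thesis
    using maximal_non_conflicted_insert[of "first_edges e k" "e (k + 1)"]
    by (simp only: recursion_step_def Let_def row_sums_ge_1_iff[OF bij]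
        compatible_edges_def[symmetric] not_False_eq_True)
qed

lemma maximal_non_conflicted_singleton: "maximal_non_conflicted {x} = {{x}}"
proof -
  have "non_conflicted {x}" by (simp add: non_conflicted_def)
  then show ?thesis unfolding maximal_non_conflicted_def subset_singleton_iff by blast
qed

lemma computed_sets_eq_maximal_non_conflicted:
  assumes "bij_betw e {1..card E} E" and "1 \<le> k" and "k \<le> card E"
  shows "computed_sets E e k = maximal_non_conflicted (first_edges e k)"
  using assms(2,3)
proof (induction k rule: dec_induct)
  case base
  show ?case by (simp add: first_edges_def maximal_non_conflicted_singleton)
next
  case (step k)
  \<comment> \<open>The recursive equation of \<open>computed_sets\<close> matches only
    \<open>Suc (Suc m)\<close>, so \<open>k\<close> has to be exposed as a successor.\<close>
  then obtain m where "k = Suc m" by (cases k) auto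
  then show ?case
    using step maximal_non_conflicted_first_edges_Suc[OF assms(1), of k] by simp
qed

theorem mainTheorem3:
  fixes n :: nat and E :: "nat set set" and e :: "nat \<Rightarrow> nat set"
    and L :: "nat \<Rightarrow> nat set set set"
  assumes "finite_loopless_graph ({1..n}, E)"
    and "E \<noteq> {}"
    and "lex_indexing E e"
    and "\<And>k. k \<in> {1..card E} \<Longrightarrow> L k = maximal_non_conflicted (first_edges e k)"
  shows "L 1 = {{e 1}}
    \<and> (\<forall>k. 1 \<le> k \<and> k < card E \<longrightarrow> L (k + 1) = recursion_step E e k (L k))
    \<and> (\<forall>k \<in> {1..card E}. computed_sets E e k = L k)
    \<and> computed_sets E e (card E) = maximal_non_conflicted E"
proof -
  have bij: "bij_betw e {1..card E} E" using assms(3) by (simp add: lex_indexing_def)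
  have "E \<subseteq> Pow {1..n}" using assms(1) by (auto simp: finite_loopless_graph_def)
  then have "finite E" by (rule finite_subset) simp
  \<comment> \<open>This puts index 1 in the range on which \<open>L\<close> is specified.\<close>
  with assms(2) have card: "1 \<le> card E" by (simp add: Suc_le_eq card_gt_0_iff)
  have computed: "computed_sets E e k = L k" if "k \<in> {1..card E}" for k
    using that assms(4) computed_sets_eq_maximal_non_conflicted[OF bij] by simp
  have "L 1 = {{e 1}}" using computed[of 1] card by simp
  moreover have "L (k + 1) = recursion_step E e k (L k)" if "1 \<le> k" "k < card E" for k
    using that assms(4) maximal_non_conflicted_first_edges_Suc[OF bij] by simp
  moreover have "first_edges e (card E) = E"
    using bij by (simp add: first_edges_def bij_betw_def)
  then have "computed_sets E e (card E) = maximal_non_conflicted E"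
    using computed_sets_eq_maximal_non_conflicted[OF bij card] by simp
  ultimately show ?thesis using computed by simp
qed

end
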